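(* Let $N\in\mathbb{N}$ and $\Delta t=1/N$. Then: (a) There exist $C>0$ and $\rho>0$, independent of $\phi$ and of $\tau$, such that $$\sup_{\tau\in\mathbb{T},\,\mathbf{x}\in\tilde Y}\Big|\big((I_{\Delta t})^{N}\big)^n\phi(\tau,\mathbf{x})-\int_{\tilde Y}\phi(\tau,\mathbf{x}')\,\pi_\tau(\mathrm{d}\mathbf{x}')\Big|\le C\|\phi\|_{L^\infty}e^{-\rho n}\qquad\forall\phi\in\mathcal{B}(\mathbb{T}\times\tilde Y),\ \forall n\in\mathbb{N}.$$ (b) If $\phi\in\mathcal{B}(\mathbb{T}\times\tilde Y)$ satisfies $\int_{\tilde Y}\phi(s,\mathbf{x})\,\pi_s(\mathrm{d}\mathbf{x})=0$ for all $s\in\mathbb{T}$, then for every $\tau\in\mathbb{T}$ and every starting point, the series $\sum_{i=1}^{\infty}\mathbb{E}\,\phi(\tau+i\Delta t,\mathbf{X}^{i})$, with $\mathbf{X}^i$ the chain started at time $\tau$, converges (its partial sums have a finite limit). (c) The kernel of $I_d-(I_{\Delta t})^N$ on $\mathcal{B}(\mathbb{T}\times\tilde Y)$ is exactly the set of functions $w(\tau,\mathbf{x})=c(\tau)$ depending only on $\tau$, with $c$ $1$-periodic.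
   Context: Let $\mathbb{T}=\mathbb{R}/\mathbb{Z}$ (time torus) and $\tilde Y=\mathbb{R}^2/\mathbb{Z}^2$ (spatial torus). Let $\sigma>0$. Let $v_1(t,x_2)$ and $v_2(t,x_1)$ be smooth real functions, $1$-periodic in each argument (so $v_1$ does not depend on $x_1$ and $v_2$ does not depend on $x_2$), with $\int_0^1 v_1(t,x_2)\,\mathrm{d}x_2=0$ for all $t$ and $\int_0^1 v_2(t,x_1)\,\mathrm{d}x_1=0$ for all $t$. Let $N\in\mathbb{N}$ and $\Delta t=1/N$. For a starting time $\tau\in\mathbb{R}$ and starting point $\mathbf{X}^0=(x_1^0,x_2^0)$, the numerical scheme generates the Markov chain $\mathbf{X}^n=(x_1^n,x_2^n)$ by $$x_1^{n+1}=x_1^n+v_1(\tau+(n+\tfrac12)\Delta t,x_2^n)\Delta t+\sigma\sqrt{\Delta t}\,\xi_1^n,$$ $$x_2^{n+1}=x_2^n+v_2\big(\tau+(n+\tfrac12)\Delta t,\;x_1^n+v_1(\tau+(n+\tfrac12)\Delta t,x_2^n)\Delta t\big)\Delta t+\sigma\sqrt{\Delta t}\,\xi_2^n,$$ where $\xi_1^n,\xi_2^n$ are i.i.d. $\mathcal{N}(0,1)$. By periodicity the chain is well defined on $\tilde Y$. $\mathcal{B}(S)$ is the space of bounded measurable functions on $S$. The one-step space-time operator $I_{\Delta t}$ on $\mathcal{B}(\mathbb{T}\times\tilde Y)$ is $(I_{\Delta t}\phi)(\tau,\mathbf{x})=\mathbb{E}[\phi(\tau+\Delta t,\mathbf{X}^1)\mid\mathbf{X}^0=\mathbf{x}]$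 for the chain started at time $\tau$; thus $((I_{\Delta t})^N\phi)(\tau,\cdot)=I_{\tau,1+\tau}\phi(\tau,\cdot)$, where $(I_{\tau,1+\tau}\psi)(\mathbf{x})=\mathbb{E}[\psi(\mathbf{X}^N)\mid\mathbf{X}^0=\mathbf{x}]$ (chain started at time $\tau$). For each $\tau$, $\pi_\tau$ denotes the unique invariant probability measure of $I_{\tau,1+\tau}$ on $\tilde Y$. *)

theory Defs
  imports "HOL-Probability.Probability"
begin

definition pd1 :: "(real \<Rightarrow> real \<Rightarrow> real) \<Rightarrow> real \<Rightarrow> real \<Rightarrow> real" where
  "pd1 f = (\<lambda>a b. deriv (\<lambda>s. f s b) a)"

definition pd2 :: "(real \<Rightarrow> real \<Rightarrow> real) \<Rightarrow> real \<Rightarrow> real \<Rightarrow> real" where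
  "pd2 f = (\<lambda>a b. deriv (\<lambda>s. f a s) b)"

fun iter_pd :: "bool list \<Rightarrow> (real \<Rightarrow> real \<Rightarrow> real) \<Rightarrow> real \<Rightarrow> real \<Rightarrow> real" where
  "iter_pd [] f = f"
| "iter_pd (b # bs) f = (if b then pd1 else pd2) (iter_pd bs f)"

definition smooth2 :: "(real \<Rightarrow> real \<Rightarrow> real) \<Rightarrow> bool" where
  "smooth2 f \<longleftrightarrow> (\<forall>bs z. (\<lambda>p. iter_pd bs f (fst p) (snd p)) differentiable (at z))"

definition gauss2 :: "(real \<times> real) measure" where
  "gauss2 = density lborel std_normal_density \<Otimes>\<^sub>M density lborel std_normal_density"

definition step :: "(real \<Rightarrow> real \<Rightarrow> real) \<Rightarrow> (real \<Rightarrow> real \<Rightarrow> real) \<Rightarrow> real \<Rightarrow> nat \<Rightarrow>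
    real \<Rightarrow> nat \<Rightarrow> real \<times> real \<Rightarrow> real \<times> real \<Rightarrow> real \<times> real" where
  "step v1 v2 \<sigma> N \<tau> n x \<xi> =
    (let dt = 1 / real N;
         t = \<tau> + (real n + 1/2) * dt;
         y1 = fst x + v1 t (snd x) * dt
     in (y1 + \<sigma> * sqrt dt * fst \<xi>,
         snd x + v2 t y1 * dt + \<sigma> * sqrt dt * snd \<xi>))"

primrec chain :: "(real \<Rightarrow> real \<Rightarrow> real) \<Rightarrow> (real \<Rightarrow> real \<Rightarrow> real) \<Rightarrow> real \<Rightarrow> nat \<Rightarrow>
    real \<Rightarrow> real \<times> real \<Rightarrow> (nat \<Rightarrow> real \<times> real) \<Rightarrow> nat \<Rightarrow> real \<times> real" where
  "chain v1 v2 \<sigma> N \<tau> x \<xi> 0 = x"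
| "chain v1 v2 \<sigma> N \<tau> x \<xi> (Suc n) = step v1 v2 \<sigma> N \<tau> n (chain v1 v2 \<sigma> N \<tau> x \<xi> n) (\<xi> n)"

definition noise :: "nat \<Rightarrow> (nat \<Rightarrow> real \<times> real) measure" where
  "noise i = PiM {..<i} (\<lambda>_. gauss2)"

definition chain_exp :: "(real \<Rightarrow> real \<Rightarrow> real) \<Rightarrow> (real \<Rightarrow> real \<Rightarrow> real) \<Rightarrow> real \<Rightarrow> nat \<Rightarrow>
    real \<Rightarrow> real \<times> real \<Rightarrow> nat \<Rightarrow> (real \<times> real \<Rightarrow> real) \<Rightarrow> real" where
  "chain_exp v1 v2 \<sigma> N \<tau> x i \<psi> = (\<integral>\<xi>. \<psi> (chain v1 v2 \<sigma> N \<tau> x \<xi> i) \<partial>noise i)"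

definition Idt :: "(real \<Rightarrow> real \<Rightarrow> real) \<Rightarrow> (real \<Rightarrow> real \<Rightarrow> real) \<Rightarrow> real \<Rightarrow> nat \<Rightarrow>
    (real \<Rightarrow> real \<times> real \<Rightarrow> real) \<Rightarrow> real \<Rightarrow> real \<times> real \<Rightarrow> real" where
  "Idt v1 v2 \<sigma> N \<phi> \<tau> x = (\<integral>\<xi>. \<phi> (\<tau> + 1 / real N) (step v1 v2 \<sigma> N \<tau> 0 x \<xi>) \<partial>gauss2)"

definition Iper :: "(real \<Rightarrow> real \<Rightarrow> real) \<Rightarrow> (real \<Rightarrow> real \<Rightarrow> real) \<Rightarrow> real \<Rightarrow> nat \<Rightarrow>
    real \<Rightarrow> (real \<times> real \<Rightarrow> real) \<Rightarrow> real \<times> real \<Rightarrow> real" where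
  "Iper v1 v2 \<sigma> N \<tau> \<psi> x = chain_exp v1 v2 \<sigma> N \<tau> x N \<psi>"

section \<open>Function spaces on the tori (functions on R resp. R^2, 1-periodic)\<close>

definition BY :: "(real \<times> real \<Rightarrow> real) set" where
  "BY = {\<psi>. \<psi> \<in> borel_measurable borel \<and> bounded (range \<psi>) \<and>
            (\<forall>a b. \<psi> (a + 1, b) = \<psi> (a, b) \<and> \<psi> (a, b + 1) = \<psi> (a, b))}"

definition BTY :: "(real \<Rightarrow> real \<times> real \<Rightarrow> real) set" where
  "BTY = {\<phi>. (\<lambda>p. \<phi> (fst p) (snd p)) \<in> borel_measurable borel \<and>
             bounded (range (\<lambda>p. \<phi> (fst p) (snd p))) \<and>
             (\<forall>\<tau> x. \<phi> (\<tau> + 1) x = \<phi> \<tau> x) \<and>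
             (\<forall>\<tau> a b. \<phi> \<tau> (a + 1, b) = \<phi> \<tau> (a, b) \<and> \<phi> \<tau> (a, b + 1) = \<phi> \<tau> (a, b))}"

definition supnorm :: "(real \<Rightarrow> real \<times> real \<Rightarrow> real) \<Rightarrow> real" where
  "supnorm \<phi> = (SUP p. \<bar>\<phi> (fst p) (snd p)\<bar>)"

text \<open>Probability measures on the torus Y~, represented on the fundamental domain [0,1)^2.\<close>
definition torus_prob :: "(real \<times> real) measure \<Rightarrow> bool" where
  "torus_prob \<mu> \<longleftrightarrow> prob_space \<mu> \<and> sets \<mu> = sets borel \<and>
       measure \<mu> ({0..<1} \<times> {0..<1}) = 1"

definition invariant :: "(real \<Rightarrow> real \<Rightarrow> real) \<Rightarrow> (real \<Rightarrow> real \<Rightarrow> real) \<Rightarrow> real \<Rightarrow> nat \<Rightarrow>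
    real \<Rightarrow> (real \<times> real) measure \<Rightarrow> bool" where
  "invariant v1 v2 \<sigma> N \<tau> \<mu> \<longleftrightarrow>
     (\<forall>\<psi>\<in>BY. (\<integral>x. Iper v1 v2 \<sigma> N \<tau> \<psi> x \<partial>\<mu>) = (\<integral>x. \<psi> x \<partial>\<mu>))"

definition pi_inv :: "(real \<Rightarrow> real \<Rightarrow> real) \<Rightarrow> (real \<Rightarrow> real \<Rightarrow> real) \<Rightarrow> real \<Rightarrow> nat \<Rightarrow>
    real \<Rightarrow> (real \<times> real) measure" where
  "pi_inv v1 v2 \<sigma> N \<tau> = (THE \<mu>. torus_prob \<mu> \<and> invariant v1 v2 \<sigma> N \<tau> \<mu>)"

end

theory Submission
  imports Defs
begin

text \<open>
  Wrapped around the torus, one step of the scheme is a deterministic map followed by a nondegenerate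
  Gaussian, whose density is bounded below by some \<open>\<delta> > 0\<close> whatever the starting point and the time.
  This is Doeblin's condition: a step is a mixture that forgets the present state with probability
  \<open>\<delta>\<close>, so it shrinks the oscillation of every bounded observable by the factor \<open>1 - \<delta>\<close>, and the law of
  the chain seen at its last forgetting time gives a stationary law of the period kernel. The scheme
  started from \<open>\<pi>\<^sub>\<tau>\<close> has the law \<open>\<pi>\<^sub>t\<close> at each later time \<open>t\<close>, since that law is stationary for the
  period started at \<open>t\<close>. Comparing the chain started from a point with the one started from \<open>\<pi>\<^sub>\<tau>\<close>
  yields the rate over whole periods and the decay of centred observables alike.
\<close>

section \<open>Laws of Markov chains in the Giry monad\<close>

lemma integral_in_interval:
  fixes f :: "'a \<Rightarrow> real"
  assumes "\<mu> \<in> space (prob_algebra M)" "f \<in> borel_measurable M" "f \<in> space M \<rightarrow> {l..u}"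
  shows "(\<integral>x. f x \<partial>\<mu>) \<in> {l..u}"
proof -
  have \<mu>: "prob_space \<mu>" "sets \<mu> = sets M"
    using assms(1) by (auto simp: space_prob_algebra)
  interpret prob_space \<mu> by (rule \<mu>)
  have range: "f x \<in> {l..u}" if "x \<in> space \<mu>" for x
    using assms(3) that sets_eq_imp_space_eq[OF \<mu>(2)] by auto
  then have "integrable \<mu> f"
    using assms(2) \<mu>(2)
    by (intro integrable_const_bound[where B="max \<bar>l\<bar> \<bar>u\<bar>"] AE_I2)
       (fastforce cong: measurable_cong_sets)+
  with range show ?thesis
    by (auto intro!: integral_ge_const integral_le_const AE_I2)
qed

lemma integral_bind_prob_algebra:
  fixes f :: "'b \<Rightarrow> real"
  assumes "\<mu> \<in> space (prob_algebra M)" "K \<in> M \<rightarrow>\<^sub>M prob_algebra N"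
    and "f \<in> borel_measurable N" "f \<in> space N \<rightarrow> {l..u}"
  shows "(\<integral>y. f y \<partial>(\<mu> \<bind> K)) = (\<integral>x. (\<integral>y. f y \<partial>K x) \<partial>\<mu>)"
proof (rule integral_bind[where K=N])
  have \<mu>: "prob_space \<mu>" "sets \<mu> = sets M"
    using assms(1) by (auto simp: space_prob_algebra)
  then show "finite_measure \<mu>"
    by (simp add: prob_space.finite_measure)
  show K: "K \<in> \<mu> \<rightarrow>\<^sub>M subprob_algebra N"
    using measurable_prob_algebraD[OF assms(2)] \<mu>(2) by (simp cong: measurable_cong_sets)
  show "AE x in \<mu>. emeasure (K x) (space (K x)) \<le> ennreal 1"
    using subprob_space_kernel[OF K] by (auto simp: subprob_space.emeasure_space_le_1)
  show "\<bar>f y\<bar> \<le> max \<bar>l\<bar> \<bar>u\<bar>" if "y \<in> space N" for y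
    using Pi_mem[OF assms(4) that] by auto
qed (rule assms)

lemma return_in_prob_algebra: "x \<in> space M \<Longrightarrow> return M x \<in> space (prob_algebra M)"
  by (simp add: space_prob_algebra prob_space_return)

lemma bind_in_prob_algebra:
  "\<mu> \<in> space (prob_algebra M) \<Longrightarrow> K \<in> M \<rightarrow>\<^sub>M prob_algebra N \<Longrightarrow> \<mu> \<bind> K \<in> space (prob_algebra N)"
  by (simp add: space_prob_algebra prob_space_bind' sets_bind')

lemma bind_assoc_prob_algebra:
  assumes \<mu>: "\<mu> \<in> space (prob_algebra M)"
    and K: "K \<in> M \<rightarrow>\<^sub>M prob_algebra N" and L: "L \<in> N \<rightarrow>\<^sub>M prob_algebra R"
  shows "(\<mu> \<bind> K) \<bind> L = \<mu> \<bind> (\<lambda>x. K x \<bind> L)"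
proof (rule bind_assoc[OF _ measurable_prob_algebraD[OF L]])
  show "K \<in> \<mu> \<rightarrow>\<^sub>M subprob_algebra N"
    using measurable_prob_algebraD[OF K] \<mu>
    by (simp add: space_prob_algebra cong: measurable_cong_sets)
qed

lemma prob_algebra_eqI:
  assumes "\<mu> \<in> space (prob_algebra M)" "\<mu>' \<in> space (prob_algebra M)"
    and "\<And>A. A \<in> sets M \<Longrightarrow> measure \<mu> A = measure \<mu>' A"
  shows "\<mu> = \<mu>'"
proof -
  interpret \<mu>: prob_space \<mu> using assms(1) by (simp add: space_prob_algebra)
  interpret \<mu>': prob_space \<mu>' using assms(2) by (simp add: space_prob_algebra)
  show ?thesis
    using assms
    by (intro measure_eqI) (auto simp: space_prob_algebra \<mu>.emeasure_eq_measure \<mu>'.emeasure_eq_measure)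
qed

lemma measure_pmf_in_prob_algebra: "measure_pmf p \<in> space (prob_algebra (count_space UNIV))"
  by (simp add: space_prob_algebra measure_pmf.prob_space_axioms)

lemma nn_integral_geometric_pmf_unfold:
  assumes "0 < p" "p \<le> 1"
  shows "(\<integral>\<^sup>+k. f k \<partial>geometric_pmf p)
    = ennreal p * f 0 + ennreal (1 - p) * (\<integral>\<^sup>+k. f (Suc k) \<partial>geometric_pmf p)"
  using assms by (subst geometric_bind_pmf_unfold) (auto simp: mult.commute)

primrec markov_law :: "(nat \<Rightarrow> 'a \<Rightarrow> 'a measure) \<Rightarrow> nat \<Rightarrow> 'a measure \<Rightarrow> 'a measure" where
  "markov_law K 0 \<mu> = \<mu>"
| "markov_law K (Suc n) \<mu> = markov_law K n \<mu> \<bind> K n"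

lemma markov_law_add:
  "markov_law K (m + n) \<mu> = markov_law (\<lambda>i. K (m + i)) n (markov_law K m \<mu>)"
  by (induction n) simp_all

lemma markov_law_const: "\<mu> \<bind> K = \<mu> \<Longrightarrow> markov_law (\<lambda>_. K) n \<mu> = \<mu>"
  by (induction n) simp_all

lemma markov_law_in_prob_algebra:
  assumes "\<mu> \<in> space (prob_algebra M)" "\<And>i. K i \<in> M \<rightarrow>\<^sub>M prob_algebra M"
  shows "markov_law K n \<mu> \<in> space (prob_algebra M)"
  using assms by (induction n) (auto intro: bind_in_prob_algebra)

lemma measurable_markov_law:
  assumes "\<And>i. K i \<in> M \<rightarrow>\<^sub>M prob_algebra M"
  shows "(\<lambda>x. markov_law K n (return M x)) \<in> M \<rightarrow>\<^sub>M prob_algebra M"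
  by (induction n) (auto intro: measurable_bind_prob_space assms measurable_return_prob_space)

lemma markov_law_eq_bind:
  assumes \<mu>: "\<mu> \<in> space (prob_algebra M)" and K: "\<And>i. K i \<in> M \<rightarrow>\<^sub>M prob_algebra M"
  shows "markov_law K n \<mu> = \<mu> \<bind> (\<lambda>x. markov_law K n (return M x))"
proof (induction n)
  case 0
  show ?case using \<mu> by (simp add: space_prob_algebra bind_return'')
next
  case (Suc n)
  then show ?case
    by (simp add: bind_assoc_prob_algebra[OF \<mu> measurable_markov_law[OF K] K])
qed

section \<open>Doeblin's condition\<close>

locale doeblin_kernel =
  fixes M :: "'a measure" and \<nu> :: "'a measure" and \<delta> :: real and K :: "'a \<Rightarrow> 'a measure"
  assumes minorant_prob: "\<nu> \<in> space (prob_algebra M)"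
    and weight_pos: "0 < \<delta>" and weight_less_1: "\<delta> < 1"
    and kernel: "K \<in> M \<rightarrow>\<^sub>M prob_algebra M"
    and minorization: "\<And>x. x \<in> space M \<Longrightarrow> scale_measure \<delta> \<nu> \<le> K x"
begin

lemma sets_kernel_eq: "x \<in> space M \<Longrightarrow> sets (K x) = sets M"
  and prob_space_kernel: "x \<in> space M \<Longrightarrow> prob_space (K x)"
  using measurable_space[OF kernel] by (auto simp: space_prob_algebra)

lemma sets_minorant: "sets \<nu> = sets M"
  and prob_space_minorant: "prob_space \<nu>"
  using minorant_prob by (auto simp: space_prob_algebra)

lemma minorization_emeasure:
  "x \<in> space M \<Longrightarrow> ennreal \<delta> * emeasure \<nu> A \<le> emeasure (K x) A"
  using le_measureD3[OF minorization, of x A] by (simp add: sets_kernel_eq sets_minorant)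

definition residual :: "'a \<Rightarrow> 'a measure" where
  "residual x = scale_measure (1 / (1 - \<delta>)) (diff_measure (K x) (scale_measure \<delta> \<nu>))"

lemma sets_residual: "x \<in> space M \<Longrightarrow> sets (residual x) = sets M"
  by (simp add: residual_def sets_kernel_eq)

lemma emeasure_residual:
  assumes x: "x \<in> space M" and A: "A \<in> sets M"
  shows "emeasure (residual x) A
    = ennreal (1 / (1 - \<delta>)) * (emeasure (K x) A - ennreal \<delta> * emeasure \<nu> A)"
proof -
  have "emeasure (scale_measure \<delta> \<nu>) (space \<nu>) = ennreal \<delta>"
    using prob_space.emeasure_space_1[OF prob_space_minorant] by simp
  then have "finite_measure (scale_measure \<delta> \<nu>)"
    by (intro finite_measureI) (simp add: space_scale_measure)
  then show ?thesis
    unfolding residual_def using prob_space_kernel[OF x] minorization_emeasure[OF x] A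
    by (simp add: emeasure_diff_measure sets_kernel_eq[OF x] sets_minorant prob_space.finite_measure)
qed

lemma emeasure_kernel:
  assumes x: "x \<in> space M" and A: "A \<in> sets M"
  shows "emeasure (K x) A
    = ennreal \<delta> * emeasure \<nu> A + ennreal (1 - \<delta>) * emeasure (residual x) A"
proof -
  have "ennreal (1 - \<delta>) * ennreal (1 / (1 - \<delta>)) = 1"
    using weight_less_1 by (simp flip: ennreal_mult)
  then show ?thesis
    using minorization_emeasure[OF x, of A]
    by (simp add: emeasure_residual[OF x A] mult.assoc[symmetric] add_diff_inverse_ennreal)
qed

lemma prob_space_residual:
  assumes x: "x \<in> space M"
  shows "prob_space (residual x)"
proof
  have "emeasure (residual x) (space M) = ennreal (1 / (1 - \<delta>)) * (1 - ennreal \<delta>)"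
    using x in_space_prob_algebra[OF minorant_prob]
      in_space_prob_algebra[OF measurable_space[OF kernel x]]
    by (simp add: emeasure_residual)
  also have "1 - ennreal \<delta> = ennreal (1 - \<delta>)"
    using weight_pos weight_less_1 by (simp add: ennreal_minus flip: ennreal_1)
  finally have "emeasure (residual x) (space M) = 1"
    using weight_less_1 by (simp flip: ennreal_mult)
  then show "emeasure (residual x) (space (residual x)) = 1"
    by (simp add: sets_eq_imp_space_eq[OF sets_residual[OF x]])
qed

lemma measurable_residual: "residual \<in> M \<rightarrow>\<^sub>M prob_algebra M"
proof (rule measurable_prob_algebraI[OF prob_space_residual])
  show "residual \<in> M \<rightarrow>\<^sub>M subprob_algebra M"
  proof (rule measurable_subprob_algebra)
    fix A assume A: "A \<in> sets M"
    have [measurable]: "K \<in> M \<rightarrow>\<^sub>M subprob_algebra M"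
      by (rule measurable_prob_algebraD[OF kernel])
    have "(\<lambda>x. ennreal (1 / (1 - \<delta>)) * (emeasure (K x) A - ennreal \<delta> * emeasure \<nu> A))
        \<in> borel_measurable M"
      using A by measurable
    then show "(\<lambda>x. emeasure (residual x) A) \<in> borel_measurable M"
      using A by (simp add: emeasure_residual cong: measurable_cong)
  qed (simp_all add: prob_space_residual prob_space_imp_subprob_space sets_residual)
qed

text \<open>Nummelin's splitting: with probability \<open>\<delta>\<close> a step forgets the present state.\<close>

lemma kernel_eq_bind_bernoulli:
  assumes x: "x \<in> space M"
  shows "K x = measure_pmf (bernoulli_pmf \<delta>) \<bind> (\<lambda>b. if b then \<nu> else residual x)"
proof (rule measure_eqI)
  let ?coin = "measure_pmf (bernoulli_pmf \<delta>)" and ?split = "\<lambda>b. if b then \<nu> else residual x"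
  note coin = measure_pmf_in_prob_algebra[of "bernoulli_pmf \<delta>"]
  have split: "?split \<in> count_space UNIV \<rightarrow>\<^sub>M prob_algebra M"
    using minorant_prob measurable_space[OF measurable_residual x] by simp
  show "sets (K x) = sets (?coin \<bind> ?split)"
    by (simp only: sets_bind'[OF coin split] sets_kernel_eq[OF x])
  show "emeasure (K x) A = emeasure (?coin \<bind> ?split) A" if "A \<in> sets (K x)" for A
    using that weight_pos weight_less_1
    by (simp add: emeasure_bind_prob_algebra[OF coin split] emeasure_kernel[OF x] sets_kernel_eq[OF x]
        mult.commute)
qed

lemma integral_kernel:
  fixes f :: "'a \<Rightarrow> real"
  assumes x: "x \<in> space M" and f: "f \<in> borel_measurable M" "f \<in> space M \<rightarrow> {l..u}"
  shows "(\<integral>y. f y \<partial>K x) = \<delta> * (\<integral>y. f y \<partial>\<nu>) + (1 - \<delta>) * (\<integral>y. f y \<partial>residual x)"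
proof -
  have "(\<integral>y. f y \<partial>K x) = (\<integral>b. (\<integral>y. f y \<partial>(if b then \<nu> else residual x)) \<partial>bernoulli_pmf \<delta>)"
    using minorant_prob measurable_space[OF measurable_residual x] f
    by (subst kernel_eq_bind_bernoulli[OF x],
        intro integral_bind_prob_algebra[OF measure_pmf_in_prob_algebra]) auto
  then show ?thesis
    using weight_pos weight_less_1 by (simp add: mult.commute)
qed

lemma integral_kernel_contracts:
  fixes f :: "'a \<Rightarrow> real"
  assumes f: "f \<in> borel_measurable M" "f \<in> space M \<rightarrow> {l..u}"
  shows "\<exists>l'. (\<lambda>x. \<integral>y. f y \<partial>K x) \<in> space M \<rightarrow> {l'..l' + (1 - \<delta>) * (u - l)}"
proof -
  define l' where "l' = \<delta> * (\<integral>y. f y \<partial>\<nu>) + (1 - \<delta>) * l"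
  have "(\<integral>y. f y \<partial>K x) \<in> {l'..l' + (1 - \<delta>) * (u - l)}" if x: "x \<in> space M" for x
  proof -
    have "(\<integral>y. f y \<partial>residual x) \<in> {l..u}"
      by (rule integral_in_interval[OF measurable_space[OF measurable_residual x] f])
    then show ?thesis
      using weight_less_1
      by (simp add: l'_def integral_kernel[OF x f] distrib_left[symmetric] add.assoc)
  qed
  then show ?thesis by blast
qed

lemma emeasure_bind_kernel:
  assumes \<mu>: "\<mu> \<in> space (prob_algebra M)" and A [measurable]: "A \<in> sets M"
  shows "emeasure (\<mu> \<bind> K) A
    = ennreal \<delta> * emeasure \<nu> A + ennreal (1 - \<delta>) * emeasure (\<mu> \<bind> residual) A"
proof -
  have \<mu>': "prob_space \<mu>" "sets \<mu> = sets M" "space \<mu> = space M"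
    using \<mu> by (auto simp: space_prob_algebra dest: sets_eq_imp_space_eq)
  have [measurable]: "residual \<in> \<mu> \<rightarrow>\<^sub>M subprob_algebra M"
    using measurable_prob_algebraD[OF measurable_residual] \<mu>'(2) by (simp cong: measurable_cong_sets)
  have "emeasure (\<mu> \<bind> K) A
      = (\<integral>\<^sup>+x. ennreal \<delta> * emeasure \<nu> A + ennreal (1 - \<delta>) * emeasure (residual x) A \<partial>\<mu>)"
    unfolding emeasure_bind_prob_algebra[OF \<mu> kernel A]
    by (intro nn_integral_cong) (simp add: emeasure_kernel \<mu>'(3))
  also have "\<dots> = ennreal \<delta> * emeasure \<nu> A + ennreal (1 - \<delta>) * (\<integral>\<^sup>+x. emeasure (residual x) A \<partial>\<mu>)"
    using prob_space.emeasure_space_1[OF \<mu>'(1)] by (simp add: nn_integral_add nn_integral_cmult)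
  finally show ?thesis
    by (simp add: emeasure_bind_prob_algebra[OF \<mu> measurable_residual])
qed

text \<open>The stationary law is that of the residual chain started from \<open>\<nu>\<close> and observed at the
  geometric age of the last regeneration.\<close>

lemma stationary_exists: "\<exists>\<mu>\<in>space (prob_algebra M). \<mu> \<bind> K = \<mu>"
proof -
  let ?law = "\<lambda>k. markov_law (\<lambda>_. residual) k \<nu>" and ?age = "measure_pmf (geometric_pmf \<delta>)"
  define \<pi> where "\<pi> = ?age \<bind> ?law"
  have law: "?law k \<in> space (prob_algebra M)" for k
    by (rule markov_law_in_prob_algebra[OF minorant_prob measurable_residual])
  note age = measure_pmf_in_prob_algebra[of "geometric_pmf \<delta>"]
  have law_kernel: "?law \<in> count_space UNIV \<rightarrow>\<^sub>M prob_algebra M"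
    using law by simp
  have \<pi>: "\<pi> \<in> space (prob_algebra M)"
    unfolding \<pi>_def by (rule bind_in_prob_algebra[OF age law_kernel])
  have "\<pi> \<bind> K = \<pi>"
  proof (rule measure_eqI)
    show "sets (\<pi> \<bind> K) = sets \<pi>"
      using \<pi> by (simp add: sets_bind'[OF \<pi> kernel] space_prob_algebra)
    fix A assume "A \<in> sets (\<pi> \<bind> K)"
    then have A: "A \<in> sets M" by (simp add: sets_bind'[OF \<pi> kernel])
    have "emeasure (\<pi> \<bind> K) A = (\<integral>\<^sup>+k. emeasure (?law k \<bind> K) A \<partial>?age)"
      unfolding \<pi>_def bind_assoc_prob_algebra[OF age law_kernel kernel]
      by (rule emeasure_bind_prob_algebra[OF age measurable_bind_prob_space[OF law_kernel kernel] A])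
    also have "\<dots> = ennreal \<delta> * emeasure \<nu> A + ennreal (1 - \<delta>) * (\<integral>\<^sup>+k. emeasure (?law (Suc k)) A \<partial>?age)"
      by (simp add: emeasure_bind_kernel[OF law A] nn_integral_add nn_integral_cmult)
    also have "\<dots> = (\<integral>\<^sup>+k. emeasure (?law k) A \<partial>?age)"
      using weight_pos weight_less_1 by (subst (2) nn_integral_geometric_pmf_unfold) auto
    also have "\<dots> = emeasure \<pi> A"
      unfolding \<pi>_def by (rule emeasure_bind_prob_algebra[OF age law_kernel A, symmetric])
    finally show "emeasure (\<pi> \<bind> K) A = emeasure \<pi> A" .
  qed
  with \<pi> show ?thesis by blast
qed

lemma minorization_bind:
  assumes "\<mu> \<in> space (prob_algebra M)"
  shows "scale_measure \<delta> \<nu> \<le> \<mu> \<bind> K"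
proof -
  have "ennreal \<delta> * emeasure \<nu> A \<le> emeasure (\<mu> \<bind> K) A" if "A \<in> sets M" for A
    by (simp add: emeasure_bind_kernel[OF assms that])
  then show ?thesis
    by (intro le_measure[THEN iffD2]) (simp_all add: sets_bind'[OF assms kernel] sets_minorant)
qed

end

lemma markov_law_contracts:
  fixes f :: "'a \<Rightarrow> real"
  assumes K: "\<And>i. doeblin_kernel M \<nu> \<delta> (K i)"
    and \<mu>: "\<mu> \<in> space (prob_algebra M)" "\<mu>' \<in> space (prob_algebra M)"
    and f: "f \<in> borel_measurable M" "f \<in> space M \<rightarrow> {l..u}"
  shows "\<bar>(\<integral>x. f x \<partial>markov_law K n \<mu>) - (\<integral>x. f x \<partial>markov_law K n \<mu>')\<bar> \<le> (1 - \<delta>) ^ n * (u - l)"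
  using f
proof (induction n arbitrary: f l u)
  case 0
  then show ?case
    using integral_in_interval[OF \<mu>(1) 0] integral_in_interval[OF \<mu>(2) 0] by auto
next
  case (Suc n)
  interpret doeblin_kernel M \<nu> \<delta> "K n" by (rule K)
  let ?f' = "\<lambda>x. \<integral>y. f y \<partial>K n x"
  obtain l' where l': "?f' \<in> space M \<rightarrow> {l'..l' + (1 - \<delta>) * (u - l)}"
    using integral_kernel_contracts[OF Suc.prems] by blast
  have f': "?f' \<in> borel_measurable M"
    using measurable_prob_algebraD[OF kernel] integral_measurable_subprob_algebra[OF Suc.prems(1)]
    by (rule measurable_compose)
  have "(\<integral>x. f x \<partial>markov_law K (Suc n) \<eta>) = (\<integral>x. ?f' x \<partial>markov_law K n \<eta>)"
    if "\<eta> \<in> space (prob_algebra M)" for \<eta>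
    using markov_law_in_prob_algebra[OF that doeblin_kernel.kernel[OF K]]
    by (simp add: integral_bind_prob_algebra[OF _ kernel Suc.prems])
  then show ?case
    using Suc.IH[OF f' l'] \<mu> by (simp add: mult.assoc mult.left_commute)
qed

lemma (in doeblin_kernel) stationary_unique:
  assumes \<mu>: "\<mu> \<in> space (prob_algebra M)" "\<mu> \<bind> K = \<mu>"
    and \<mu>': "\<mu>' \<in> space (prob_algebra M)" "\<mu>' \<bind> K = \<mu>'"
  shows "\<mu> = \<mu>'"
proof (rule prob_algebra_eqI[OF \<mu>(1) \<mu>'(1)])
  fix A assume A: "A \<in> sets M"
  have "\<bar>measure \<mu> A - measure \<mu>' A\<bar> \<le> (1 - \<delta>) ^ n" for n
  proof -
    have "(\<integral>x. indicator A x \<partial>\<eta>) = measure \<eta> A" if "\<eta> \<in> space (prob_algebra M)" for \<eta>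
      using that A sets.sets_into_space[of A \<eta>] by (auto simp: space_prob_algebra Int_absorb2)
    then show ?thesis
      using markov_law_contracts[OF doeblin_kernel_axioms \<mu>(1) \<mu>'(1), of "indicator A" 0 1 n] A \<mu> \<mu>'
      by (simp add: markov_law_const indicator_def)
  qed
  moreover have "(\<lambda>n. (1 - \<delta>) ^ n) \<longlonglongrightarrow> 0"
    using weight_pos weight_less_1 by (intro LIMSEQ_power_zero) simp
  ultimately have "\<bar>measure \<mu> A - measure \<mu>' A\<bar> \<le> 0"
    by (intro LIMSEQ_le_const) auto
  then show "measure \<mu> A = measure \<mu>' A" by simp
qed

lemma doeblin_kernel_markov_law:
  assumes K: "\<And>i. doeblin_kernel M \<nu> \<delta> (K i)" and "0 < n"
  shows "doeblin_kernel M \<nu> \<delta> (\<lambda>x. markov_law K n (return M x))"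
proof
  note kernel = doeblin_kernel.kernel[OF K]
  show "(\<lambda>x. markov_law K n (return M x)) \<in> M \<rightarrow>\<^sub>M prob_algebra M"
    by (rule measurable_markov_law[OF kernel])
  obtain m where n: "n = Suc m" using \<open>0 < n\<close> gr0_implies_Suc by blast
  show "scale_measure \<delta> \<nu> \<le> markov_law K n (return M x)" if "x \<in> space M" for x
    using doeblin_kernel.minorization_bind[OF K measurable_space[OF measurable_markov_law[OF kernel] that]]
    by (simp add: n)
qed (use doeblin_kernel.minorant_prob[OF K] doeblin_kernel.weight_pos[OF K]
    doeblin_kernel.weight_less_1[OF K] in auto)

lemma markov_law_stationary_ex1:
  assumes K: "\<And>i. doeblin_kernel M \<nu> \<delta> (K i)" and "0 < n"
  shows "\<exists>!\<mu>. \<mu> \<in> space (prob_algebra M) \<and> markov_law K n \<mu> = \<mu>"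
proof -
  interpret doeblin_kernel M \<nu> \<delta> "\<lambda>x. markov_law K n (return M x)"
    using assms by (rule doeblin_kernel_markov_law)
  have "markov_law K n \<mu> = \<mu> \<longleftrightarrow> \<mu> \<bind> (\<lambda>x. markov_law K n (return M x)) = \<mu>"
    if "\<mu> \<in> space (prob_algebra M)" for \<mu>
    by (simp only: markov_law_eq_bind[OF that doeblin_kernel.kernel[OF K], symmetric])
  with stationary_exists stationary_unique show ?thesis by blast
qed

lemma markov_law_stationary_shift:
  assumes periodic: "\<And>i. K (p + i) = K i" and stationary: "markov_law K p \<mu> = \<mu>"
  shows "markov_law (\<lambda>i. K (n + i)) p (markov_law K n \<mu>) = markov_law K n \<mu>"
proof -
  have "markov_law (\<lambda>i. K (n + i)) p (markov_law K n \<mu>) = markov_law K (p + n) \<mu>"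
    by (simp only: markov_law_add[symmetric] add.commute[of p n])
  also have "\<dots> = markov_law (\<lambda>i. K (p + i)) n (markov_law K p \<mu>)"
    by (rule markov_law_add)
  finally show ?thesis by (simp only: periodic stationary)
qed

section \<open>Gaussians wrapped around the torus\<close>

lemma normal_density_antimono_dist:
  assumes "\<bar>x - \<mu>\<bar> \<le> \<bar>y - \<nu>\<bar>"
  shows "normal_density \<nu> \<sigma> y \<le> normal_density \<mu> \<sigma> x"
proof -
  have "(x - \<mu>)\<^sup>2 \<le> (y - \<nu>)\<^sup>2" using assms by (simp add: abs_le_square_iff)
  then show ?thesis by (simp add: normal_density_def divide_right_mono)
qed

lemma normal_density_0_1_less_1:
  assumes "0 < \<sigma>"
  shows "normal_density 0 \<sigma> 1 < 1"
proof -
  have "1 < 2 * pi * (\<sigma>\<^sup>2 + 1)"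
  proof -
    have "1 < 2 * pi" using pi_gt3 by simp
    also have "\<dots> \<le> 2 * pi * (\<sigma>\<^sup>2 + 1)" by simp
    finally show ?thesis .
  qed
  also have "\<dots> = 2 * pi * \<sigma>\<^sup>2 * (1 + 1 / \<sigma>\<^sup>2)"
    using assms by (simp add: field_simps)
  also have "\<dots> \<le> 2 * pi * \<sigma>\<^sup>2 * exp (1 / \<sigma>\<^sup>2)"
    by (intro mult_left_mono exp_ge_add_one_self) simp
  also have "\<dots> = (sqrt (2 * pi * \<sigma>\<^sup>2) * exp (1 / (2 * \<sigma>\<^sup>2)))\<^sup>2"
    by (simp add: power_mult_distrib exp_double[symmetric])
  finally have "1 < sqrt (2 * pi * \<sigma>\<^sup>2) * exp (1 / (2 * \<sigma>\<^sup>2))"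
    by (intro power2_less_imp_less[of 1]) simp_all
  then show ?thesis
    using assms by (simp add: normal_density_def exp_minus field_simps)
qed

lemma distr_std_normal_affine:
  assumes "0 < a"
  shows "distr (density lborel std_normal_density) borel (\<lambda>z. m + a * z)
    = density lborel (normal_density m a)"
proof -
  interpret prob_space "density lborel std_normal_density"
    by (rule prob_space_normal_density) simp
  have "distributed (density lborel std_normal_density) lborel (\<lambda>z. z) std_normal_density"
    by (simp add: distributed_def distr_id2)
  from normal_density_affine[OF this, of a m] assms show ?thesis
    by (simp add: distributed_def cong: distr_cong)
qed

lemma sets_gauss2 [measurable_cong, simp]: "sets gauss2 = sets borel"
  unfolding gauss2_def borel_prod[symmetric] by (intro sets_pair_measure_cong) simp_all

lemma prob_space_gauss2: "prob_space gauss2"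
  unfolding gauss2_def by (intro prob_space_pair prob_space_normal_density) simp_all

lemma distr_gauss2_affine:
  fixes m :: "real \<times> real"
  assumes "0 < a"
  shows "distr gauss2 borel (\<lambda>z. m + a *\<^sub>R z)
    = density lborel (\<lambda>p. ennreal (normal_density (fst m) a (fst p))
        * ennreal (normal_density (snd m) a (snd p)))"
proof -
  let ?std = "density lborel std_normal_density" and ?law = "\<lambda>m. density lborel (normal_density m a)"
  have law: "prob_space (?law c)" for c
    using assms by (rule prob_space_normal_density)
  have "distr gauss2 borel (\<lambda>z. m + a *\<^sub>R z)
      = distr gauss2 (borel \<Otimes>\<^sub>M borel) (\<lambda>(x, y). (fst m + a * x, snd m + a * y))"
    unfolding borel_prod by (intro distr_cong) (auto simp: plus_prod_def)
  also have "\<dots> = distr ?std borel (\<lambda>x. fst m + a * x) \<Otimes>\<^sub>M distr ?std borel (\<lambda>y. snd m + a * y)"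
    unfolding gauss2_def using law assms
    by (intro pair_measure_distr[symmetric])
       (simp_all add: distr_std_normal_affine prob_space_imp_sigma_finite)
  also have "\<dots> = ?law (fst m) \<Otimes>\<^sub>M ?law (snd m)"
    by (simp add: distr_std_normal_affine assms)
  also have "\<dots> = density (lborel \<Otimes>\<^sub>M lborel)
      (\<lambda>(x, y). ennreal (normal_density (fst m) a x) * ennreal (normal_density (snd m) a y))"
    using law by (intro pair_measure_density)
      (simp_all add: lborel.sigma_finite_measure_axioms prob_space_imp_sigma_finite)
  finally show ?thesis
    by (simp add: lborel_prod case_prod_beta')
qed

abbreviation unit_square :: "(real \<times> real) set" where
  "unit_square \<equiv> {0..<1} \<times> {0..<1}"

definition fold_torus :: "real \<times> real \<Rightarrow> real \<times> real" where
  "fold_torus x = (frac (fst x), frac (snd x))"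

definition uniform_torus :: "(real \<times> real) measure" where
  "uniform_torus = uniform_measure lborel unit_square"

lemma measurable_fold_torus [measurable]: "fold_torus \<in> borel \<rightarrow>\<^sub>M borel"
  unfolding fold_torus_def frac_def borel_prod[symmetric] by measurable

lemma sets_unit_square [measurable]: "unit_square \<in> sets borel"
  by (simp add: borel_Times)

lemma fold_torus_in_unit_square: "fold_torus x \<in> unit_square"
  by (simp add: fold_torus_def frac_lt_1)

lemma fold_torus_ident: "x \<in> unit_square \<Longrightarrow> fold_torus x = x"
  by (cases x) (simp add: fold_torus_def frac_eq)

lemma fold_torus_add_of_int: "fold_torus ((of_int i, of_int j) + x) = fold_torus x"
  by (simp add: fold_torus_def frac_def)

lemma emeasure_lborel_unit_square: "emeasure lborel unit_square = 1"
  by (simp add: lborel_prod[symmetric] lborel.emeasure_pair_measure_Times)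

lemma emeasure_uniform_torus:
  "A \<in> sets borel \<Longrightarrow> emeasure uniform_torus A = emeasure lborel (unit_square \<inter> A)"
  by (simp add: uniform_torus_def emeasure_lborel_unit_square divide_ennreal_def)

lemma uniform_torus_in_prob_algebra: "uniform_torus \<in> space (prob_algebra borel)"
  unfolding space_prob_algebra uniform_torus_def
  by (simp add: prob_space_uniform_measure emeasure_lborel_unit_square)

lemma scale_uniform_torus_le_wrapped_density:
  fixes f :: "real \<times> real \<Rightarrow> ennreal"
  assumes [measurable]: "f \<in> borel_measurable borel"
    and ge: "\<And>p. p \<in> unit_square \<Longrightarrow> c \<le> f ((of_int i, of_int j) + p)"
  shows "scale_measure c uniform_torus \<le> distr (density lborel f) borel fold_torus"
proof -
  let ?k = "(of_int i, of_int j) :: real \<times> real"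
  have "c * emeasure uniform_torus A \<le> emeasure (distr (density lborel f) borel fold_torus) A"
    if A [measurable]: "A \<in> sets borel" for A
  proof -
    have [measurable]: "fold_torus -` A \<in> sets borel"
      using measurable_sets[OF measurable_fold_torus A] by simp
    have "c * emeasure uniform_torus A = (\<integral>\<^sup>+p. c * indicator (unit_square \<inter> A) p \<partial>lborel)"
      by (simp add: emeasure_uniform_torus nn_integral_cmult_indicator sets_unit_square)
    also have "\<dots> \<le> (\<integral>\<^sup>+p. f (?k + p) * indicator (fold_torus -` A) (?k + p) \<partial>lborel)"
      using ge by (intro nn_integral_mono)
        (auto simp: fold_torus_add_of_int fold_torus_ident split: split_indicator)
    also have "\<dots> = (\<integral>\<^sup>+q. f q * indicator (fold_torus -` A) q \<partial>distr lborel borel ((+) ?k))"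
      by (subst nn_integral_distr) auto
    also have "\<dots> = emeasure (distr (density lborel f) borel fold_torus) A"
      unfolding lborel_distr_plus by (simp add: emeasure_distr emeasure_density)
    finally show ?thesis .
  qed
  then show ?thesis
    by (intro le_measure[THEN iffD2]) (simp_all add: uniform_torus_def)
qed

text \<open>The translate of the unit square by \<open>\<lfloor>m\<rfloor>\<close> lies within distance \<open>1\<close> of \<open>m\<close> in each coordinate,
  which makes the bound independent of \<open>m\<close>.\<close>

lemma scale_uniform_torus_le_wrapped_gauss2:
  fixes m :: "real \<times> real"
  assumes a: "0 < a"
  shows "scale_measure (ennreal ((normal_density 0 a 1)\<^sup>2)) uniform_torus
    \<le> distr gauss2 borel (\<lambda>z. fold_torus (m + a *\<^sub>R z))"
proof -
  let ?f = "\<lambda>p. ennreal (normal_density (fst m) a (fst p)) * ennreal (normal_density (snd m) a (snd p))"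
  have near: "normal_density 0 a 1 \<le> normal_density c a (of_int \<lfloor>c\<rfloor> + t)" if "t \<in> {0..<1}" for c t
    using that by (intro normal_density_antimono_dist) (auto simp: abs_le_iff; linarith)
  have "scale_measure (ennreal ((normal_density 0 a 1)\<^sup>2)) uniform_torus
      \<le> distr (density lborel ?f) borel fold_torus"
  proof (rule scale_uniform_torus_le_wrapped_density)
    show "ennreal ((normal_density 0 a 1)\<^sup>2) \<le> ?f ((of_int \<lfloor>fst m\<rfloor>, of_int \<lfloor>snd m\<rfloor>) + p)"
      if "p \<in> unit_square" for p
      using that near by (auto simp: power2_eq_square ennreal_mult' intro!: mult_mono ennreal_leI)
  qed (unfold borel_prod[symmetric], measurable)
  also have "distr (density lborel ?f) borel fold_torus
      = distr gauss2 borel (\<lambda>z. fold_torus (m + a *\<^sub>R z))"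
    unfolding distr_gauss2_affine[OF a, symmetric] by (subst distr_distr) (auto simp: comp_def)
  finally show ?thesis .
qed

section \<open>Periodic observables\<close>

lemma fold_torus_decomp: "(of_int \<lfloor>fst x\<rfloor>, of_int \<lfloor>snd x\<rfloor>) + fold_torus x = x"
  by (simp add: fold_torus_def frac_def prod_eq_iff)

lemma BY_iff_fold_torus:
  "\<psi> \<in> BY \<longleftrightarrow> \<psi> \<in> borel_measurable borel \<and> bounded (range \<psi>) \<and> (\<forall>x. \<psi> (fold_torus x) = \<psi> x)"
proof -
  have "(\<forall>a b. \<psi> (a + 1, b) = \<psi> (a, b) \<and> \<psi> (a, b + 1) = \<psi> (a, b)) \<longleftrightarrow> (\<forall>x. \<psi> (fold_torus x) = \<psi> x)"
    (is "?periodic \<longleftrightarrow> ?factors")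
  proof
    assume ?periodic
    then interpret fst: periodic_fun_simple' "\<lambda>a. \<psi> (a, b)" for b
      by unfold_locales blast
    from \<open>?periodic\<close> interpret snd: periodic_fun_simple' "\<lambda>b. \<psi> (a, b)" for a
      by unfold_locales blast
    show ?factors
      by (simp add: fold_torus_def frac_def fst.minus_of_int snd.minus_of_int)
  next
    assume ?factors
    moreover have "fold_torus (a + 1, b) = fold_torus (a, b)" "fold_torus (a, b + 1) = fold_torus (a, b)"
      for a b
      by (simp_all add: fold_torus_def frac_def)
    ultimately show ?periodic by metis
  qed
  then show ?thesis by (simp add: BY_def)
qed

lemma BY_fold_torus: "\<psi> \<in> BY \<Longrightarrow> \<psi> (fold_torus x) = \<psi> x"
  by (simp only: BY_iff_fold_torus)

lemma BY_measurable: "\<psi> \<in> BY \<Longrightarrow> \<psi> \<in> borel_measurable borel"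
  by (simp add: BY_def)

lemma BY_obtain_range:
  assumes "\<psi> \<in> BY"
  obtains B where "\<psi> \<in> UNIV \<rightarrow> {- B..B}"
proof -
  obtain B where "\<And>x. \<bar>\<psi> x\<bar> \<le> B"
    using assms by (auto simp: BY_def bounded_iff)
  then have "\<psi> \<in> UNIV \<rightarrow> {- B..B}"
    by (auto simp: abs_le_iff minus_le_iff)
  then show ?thesis by (rule that)
qed

lemma indicator_fold_torus_in_BY:
  assumes "A \<in> sets borel"
  shows "(\<lambda>x. indicator A (fold_torus x)) \<in> BY"
proof -
  have "bounded (range (\<lambda>x. indicator A (fold_torus x) :: real))"
    by (rule boundedI[of _ 1]) (auto simp: indicator_def)
  with assms show ?thesis
    by (simp add: BY_iff_fold_torus fold_torus_ident[OF fold_torus_in_unit_square])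
qed

lemma torus_prob_iff_AE:
  "torus_prob \<mu> \<longleftrightarrow> \<mu> \<in> space (prob_algebra borel) \<and> (AE x in \<mu>. x \<in> unit_square)"
proof -
  have "measure \<mu> unit_square = 1 \<longleftrightarrow> (AE x in \<mu>. x \<in> unit_square)"
    if "prob_space \<mu>" "sets \<mu> = sets borel"
    using prob_space.prob_eq_1[OF that(1)] by (simp only: that(2) sets_unit_square)
  then show ?thesis
    by (simp only: torus_prob_def space_prob_algebra mem_Collect_eq) blast
qed

lemma torus_prob_eqI:
  assumes \<mu>: "torus_prob \<mu>" and \<mu>': "torus_prob \<mu>'"
    and eq: "\<And>\<psi>. \<psi> \<in> BY \<Longrightarrow> (\<integral>x. \<psi> x \<partial>\<mu>) = (\<integral>x. \<psi> x \<partial>\<mu>')"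
  shows "\<mu> = \<mu>'"
proof (rule prob_algebra_eqI)
  fix A :: "(real \<times> real) set" assume A [measurable]: "A \<in> sets borel"
  have "measure \<eta> A = (\<integral>x. indicator A (fold_torus x) \<partial>\<eta>)" if "torus_prob \<eta>" for \<eta>
  proof -
    have [measurable_cong]: "sets \<eta> = sets borel"
      using that by (simp add: torus_prob_def)
    have "(\<integral>x. indicator A (fold_torus x) \<partial>\<eta>) = (\<integral>x. indicat_real A x \<partial>\<eta>)"
      using that by (intro integral_cong_AE) (auto simp: torus_prob_iff_AE fold_torus_ident)
    then show ?thesis
      using sets_eq_imp_space_eq[OF \<open>sets \<eta> = sets borel\<close>] by simp
  qed
  then show "measure \<mu> A = measure \<mu>' A"
    using \<mu> \<mu>' eq[OF indicator_fold_torus_in_BY[OF A]] by simp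
qed (use \<mu> \<mu>' in \<open>auto simp: torus_prob_iff_AE\<close>)

lemma BTY_slice:
  assumes \<phi>: "\<phi> \<in> BTY"
  shows "\<phi> s \<in> BY"
proof -
  have "(\<lambda>x. (s, x)) \<in> borel \<rightarrow>\<^sub>M (borel :: (real \<times> real \<times> real) measure)"
    by (intro borel_measurable_continuous_onI continuous_intros)
  from measurable_compose[OF this, of "\<lambda>p. \<phi> (fst p) (snd p)"] \<phi>
  have "\<phi> s \<in> borel_measurable borel" by (simp add: BTY_def)
  moreover have "range (\<phi> s) \<subseteq> range (\<lambda>p. \<phi> (fst p) (snd p))"
    by (auto intro: image_eqI[of _ _ "(s, _)"])
  ultimately show ?thesis
    using \<phi> by (auto simp: BTY_def BY_def intro: bounded_subset)
qed

lemma BTY_range_supnorm: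
  assumes "\<phi> \<in> BTY"
  shows "\<phi> s \<in> UNIV \<rightarrow> {- supnorm \<phi>..supnorm \<phi>}"
proof
  fix x
  from assms obtain B where "\<forall>p. \<bar>\<phi> (fst p) (snd p)\<bar> \<le> B"
    by (auto simp: BTY_def bounded_iff)
  then have "bdd_above (range (\<lambda>p. \<bar>\<phi> (fst p) (snd p)\<bar>))"
    by (intro bdd_aboveI2[of _ _ B]) blast
  from cSUP_upper[OF _ this, of "(s, x)"] have "\<bar>\<phi> s x\<bar> \<le> supnorm \<phi>"
    by (simp add: supnorm_def)
  then show "\<phi> s x \<in> {- supnorm \<phi>..supnorm \<phi>}"
    by (simp add: abs_le_iff minus_le_iff)
qed

lemma BTY_add_of_nat:
  assumes "\<phi> \<in> BTY"
  shows "\<phi> (\<tau> + real n) = \<phi> \<tau>"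
proof -
  interpret periodic_fun_simple' \<phi>
    using assms by unfold_locales (auto simp: BTY_def)
  show ?thesis by (rule plus_of_nat)
qed

section \<open>The splitting scheme\<close>

lemma chain_cong:
  "(\<And>j. j < i \<Longrightarrow> \<xi> j = \<xi>' j) \<Longrightarrow> chain v1 v2 \<sigma> N \<tau> x \<xi> i = chain v1 v2 \<sigma> N \<tau> x \<xi>' i"
  by (induction i) auto

lemma prob_space_noise: "prob_space (noise i)"
  unfolding noise_def by (intro prob_space_PiM prob_space_gauss2)

locale splitting_scheme =
  fixes v1 v2 :: "real \<Rightarrow> real \<Rightarrow> real" and \<sigma> :: real and N :: nat
  assumes sigma_pos: "\<sigma> > 0"
    and N_pos: "N > 0"
    and v1_measurable [measurable]: "\<And>t. v1 t \<in> borel_measurable borel"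
    and v2_measurable [measurable]: "\<And>t. v2 t \<in> borel_measurable borel"
    and v1_periodic: "\<And>t. v1 (t + 1) = v1 t" "\<And>t y. v1 t (y + 1) = v1 t y"
    and v2_periodic: "\<And>t. v2 (t + 1) = v2 t" "\<And>t y. v2 t (y + 1) = v2 t y"
begin

definition noise_scale :: real where
  "noise_scale = \<sigma> * sqrt (1 / real N)"

definition drift_map :: "real \<Rightarrow> real \<times> real \<Rightarrow> real \<times> real" where
  "drift_map s x = (let t = s + 1 / 2 / real N; y = fst x + v1 t (snd x) / real N
     in (y, snd x + v2 t y / real N))"

definition torus_kernel :: "real \<Rightarrow> real \<times> real \<Rightarrow> (real \<times> real) measure" where
  "torus_kernel s x = distr gauss2 borel (\<lambda>\<xi>. fold_torus (drift_map s x + noise_scale *\<^sub>R \<xi>))"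

definition minorization_weight :: real (\<open>\<delta>\<close>) where
  "\<delta> = (normal_density 0 noise_scale 1)\<^sup>2"

lemma noise_scale_pos: "noise_scale > 0"
  using sigma_pos N_pos by (simp add: noise_scale_def)

lemma step_eq: "step v1 v2 \<sigma> N \<tau> n x \<xi> = drift_map (\<tau> + real n / real N) x + noise_scale *\<^sub>R \<xi>"
  by (simp add: step_def drift_map_def noise_scale_def Let_def add_divide_distrib add.assoc prod_eq_iff)

lemma drift_map_add_1: "drift_map (s + 1) = drift_map s"
proof -
  have "s + 1 + 1 / 2 / real N = s + 1 / 2 / real N + 1" by simp
  then show ?thesis
    unfolding drift_map_def Let_def by (simp only: v1_periodic v2_periodic)
qed

lemma drift_map_add_of_int:
  "drift_map s ((of_int i, of_int j) + x) = (of_int i, of_int j) + drift_map s x"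
proof -
  interpret v1: periodic_fun_simple' "v1 t" for t by unfold_locales (rule v1_periodic)
  interpret v2: periodic_fun_simple' "v2 t" for t by unfold_locales (rule v2_periodic)
  have "v1 t (of_int k + y) = v1 t y" "v2 t (of_int k + y + z) = v2 t (y + z)" for t y z k
    using v1.plus_of_int[of t y k] v2.plus_of_int[of t "y + z" k] by (simp_all add: ac_simps)
  then show ?thesis by (simp add: drift_map_def Let_def prod_eq_iff)
qed

lemma measurable_drift_map [measurable]: "drift_map s \<in> borel \<rightarrow>\<^sub>M borel"
  unfolding drift_map_def Let_def borel_prod[symmetric] by measurable

lemma measurable_step [measurable]:
  "(\<lambda>p. step v1 v2 \<sigma> N \<tau> n (fst p) (snd p)) \<in> borel \<Otimes>\<^sub>M borel \<rightarrow>\<^sub>M borel"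
  unfolding step_eq by measurable

lemma torus_kernel_add_1: "torus_kernel (s + 1) = torus_kernel s"
  by (simp add: torus_kernel_def drift_map_add_1 fun_eq_iff)

lemma torus_kernel_fold_torus: "torus_kernel s (fold_torus x) = torus_kernel s x"
proof -
  let ?k = "(of_int \<lfloor>fst x\<rfloor>, of_int \<lfloor>snd x\<rfloor>) :: real \<times> real"
  have "drift_map s x = ?k + drift_map s (fold_torus x)"
    using drift_map_add_of_int[of s "\<lfloor>fst x\<rfloor>" "\<lfloor>snd x\<rfloor>" "fold_torus x"]
    by (simp only: fold_torus_decomp)
  then show ?thesis
    by (simp add: torus_kernel_def add.assoc fold_torus_add_of_int)
qed

lemma measurable_torus_kernel: "torus_kernel s \<in> borel \<rightarrow>\<^sub>M prob_algebra borel"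
proof -
  have "(\<lambda>x. gauss2) \<in> borel \<rightarrow>\<^sub>M prob_algebra borel"
    using prob_space_gauss2 by (simp add: space_prob_algebra)
  then show ?thesis
    unfolding torus_kernel_def[abs_def]
    by (rule measurable_distr_prob_space2) measurable
qed

lemma torus_kernel_doeblin: "doeblin_kernel borel uniform_torus \<delta> (torus_kernel s)"
proof
  show "0 < \<delta>" "\<delta> < 1"
    using normal_density_pos[OF noise_scale_pos, of 0 1] normal_density_0_1_less_1[OF noise_scale_pos]
    by (simp_all add: minorization_weight_def power_less_one_iff)
  show "scale_measure \<delta> uniform_torus \<le> torus_kernel s x" for x
    unfolding torus_kernel_def minorization_weight_def
    by (rule scale_uniform_torus_le_wrapped_gauss2[OF noise_scale_pos])
qed (rule uniform_torus_in_prob_algebra measurable_torus_kernel)+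

lemmas weight_pos = doeblin_kernel.weight_pos[OF torus_kernel_doeblin]
  and weight_less_1 = doeblin_kernel.weight_less_1[OF torus_kernel_doeblin]

lemma integral_torus_kernel:
  assumes "\<psi> \<in> BY"
  shows "(\<integral>y. \<psi> y \<partial>torus_kernel (\<tau> + real n / real N) x) = (\<integral>\<xi>. \<psi> (step v1 v2 \<sigma> N \<tau> n x \<xi>) \<partial>gauss2)"
  unfolding torus_kernel_def using assms
  by (subst integral_distr) (simp_all add: BY_fold_torus BY_measurable step_eq)

lemma integral_torus_kernel_in_BY:
  assumes \<psi>: "\<psi> \<in> BY"
  shows "(\<lambda>x. \<integral>y. \<psi> y \<partial>torus_kernel s x) \<in> BY"
proof -
  have \<psi>_measurable: "\<psi> \<in> borel_measurable borel"
    using \<psi> by (simp add: BY_def)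
  obtain B where "\<psi> \<in> UNIV \<rightarrow> {- B..B}"
    using \<psi> by (rule BY_obtain_range)
  then have "(\<integral>y. \<psi> y \<partial>torus_kernel s x) \<in> {- B..B}" for x
    by (intro integral_in_interval[OF measurable_space[OF measurable_torus_kernel] \<psi>_measurable]) auto
  then have "bounded (range (\<lambda>x. \<integral>y. \<psi> y \<partial>torus_kernel s x))"
    by (intro boundedI[of _ B]) (auto simp: abs_le_iff minus_le_iff)
  moreover have "(\<lambda>x. \<integral>y. \<psi> y \<partial>torus_kernel s x) \<in> borel_measurable borel"
    using measurable_prob_algebraD[OF measurable_torus_kernel]
      integral_measurable_subprob_algebra[OF \<psi>_measurable]
    by (rule measurable_compose)
  ultimately show ?thesis
    by (simp add: BY_iff_fold_torus torus_kernel_fold_torus)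
qed

definition law :: "real \<Rightarrow> nat \<Rightarrow> (real \<times> real) measure \<Rightarrow> (real \<times> real) measure" where
  "law \<tau> = markov_law (\<lambda>i. torus_kernel (\<tau> + real i / real N))"

lemma law_0: "law \<tau> 0 \<mu> = \<mu>"
  by (simp add: law_def)

lemma law_Suc: "law \<tau> (Suc n) \<mu> = law \<tau> n \<mu> \<bind> torus_kernel (\<tau> + real n / real N)"
  by (simp add: law_def)

lemma law_in_prob_algebra: "\<mu> \<in> space (prob_algebra borel) \<Longrightarrow> law \<tau> n \<mu> \<in> space (prob_algebra borel)"
  unfolding law_def by (rule markov_law_in_prob_algebra[OF _ measurable_torus_kernel])

lemma integral_law_Suc:
  assumes "\<mu> \<in> space (prob_algebra borel)" and \<psi>: "\<psi> \<in> BY"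
  shows "(\<integral>y. \<psi> y \<partial>law \<tau> (Suc n) \<mu>)
    = (\<integral>x. (\<integral>y. \<psi> y \<partial>torus_kernel (\<tau> + real n / real N) x) \<partial>law \<tau> n \<mu>)"
proof -
  obtain B where "\<psi> \<in> UNIV \<rightarrow> {- B..B}"
    using \<psi> by (rule BY_obtain_range)
  with assms show ?thesis
    unfolding law_Suc BY_def
    by (intro integral_bind_prob_algebra[OF law_in_prob_algebra measurable_torus_kernel]) auto
qed

lemma AE_law_unit_square:
  assumes "\<mu> \<in> space (prob_algebra borel)" and "0 < n"
  shows "AE x in law \<tau> n \<mu>. x \<in> unit_square"
proof -
  obtain m where n: "n = Suc m" using \<open>0 < n\<close> gr0_implies_Suc by blast
  have law: "sets (law \<tau> m \<mu>) = sets borel"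
    using law_in_prob_algebra[OF assms(1)] by (simp add: space_prob_algebra)
  have "AE y in torus_kernel s x. y \<in> unit_square" for s x
    unfolding torus_kernel_def
    by (subst AE_distr_iff) (auto simp: sets_unit_square fold_torus_in_unit_square)
  then show ?thesis
    using measurable_prob_algebraD[OF measurable_torus_kernel] law
    unfolding n law_Suc by (subst AE_bind[where B=borel]) (auto cong: measurable_cong_sets)
qed

lemma measurable_chain:
  "i \<le> k \<Longrightarrow> (\<lambda>\<xi>. chain v1 v2 \<sigma> N \<tau> x \<xi> i) \<in> noise k \<rightarrow>\<^sub>M borel"
proof (induction i)
  case 0
  then show ?case by simp
next
  case (Suc i)
  have [measurable]: "(\<lambda>\<xi>. chain v1 v2 \<sigma> N \<tau> x \<xi> i) \<in> noise k \<rightarrow>\<^sub>M borel"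
    using Suc by simp
  have [measurable]: "(\<lambda>\<xi>. \<xi> i) \<in> noise k \<rightarrow>\<^sub>M borel"
    using Suc.prems measurable_component_singleton[of i "{..<k}" "\<lambda>_. gauss2"]
    by (simp add: noise_def cong: measurable_cong_sets)
  show ?case
    using measurable_compose[OF _ measurable_step[of \<tau> i],
        of "\<lambda>\<xi>. (chain v1 v2 \<sigma> N \<tau> x \<xi> i, \<xi> i)" "noise k"]
    by simp
qed

lemma chain_exp_Suc:
  assumes \<psi>: "\<psi> \<in> BY"
  shows "chain_exp v1 v2 \<sigma> N \<tau> x (Suc i) \<psi>
    = chain_exp v1 v2 \<sigma> N \<tau> x i (\<lambda>y. \<integral>z. \<psi> z \<partial>torus_kernel (\<tau> + real i / real N) y)"
proof -
  let ?chain = "chain v1 v2 \<sigma> N \<tau> x"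
  interpret gauss2: prob_space gauss2 by (rule prob_space_gauss2)
  interpret product_sigma_finite "\<lambda>_. gauss2" ..
  interpret noise: prob_space "noise (Suc i)" by (rule prob_space_noise)
  obtain B where "\<psi> \<in> UNIV \<rightarrow> {- B..B}"
    using \<psi> by (rule BY_obtain_range)
  then have "AE \<xi> in noise (Suc i). norm (\<psi> (?chain \<xi> (Suc i))) \<le> B"
    by (intro AE_I2) (simp only: Pi_iff UNIV_I atLeastAtMost_iff real_norm_def abs_le_iff minus_le_iff)
  then have "integrable (noise (Suc i)) (\<lambda>\<xi>. \<psi> (?chain \<xi> (Suc i)))"
    using \<psi> measurable_compose[OF measurable_chain[of "Suc i" "Suc i"], of \<psi> borel]
    by (intro noise.integrable_const_bound[where B=B]) (simp_all add: BY_def del: chain.simps)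
  then have "chain_exp v1 v2 \<sigma> N \<tau> x (Suc i) \<psi>
      = (\<integral>\<xi>. (\<integral>z. \<psi> (?chain (\<xi>(i := z)) (Suc i)) \<partial>gauss2) \<partial>noise i)"
    unfolding chain_exp_def noise_def lessThan_Suc by (intro product_integral_insert) auto
  also have "\<dots> = (\<integral>\<xi>. (\<integral>z. \<psi> (step v1 v2 \<sigma> N \<tau> i (?chain \<xi> i) z) \<partial>gauss2) \<partial>noise i)"
  proof -
    have "?chain (\<xi>(i := z)) i = ?chain \<xi> i" for \<xi> z by (rule chain_cong) auto
    then show ?thesis by simp
  qed
  finally show ?thesis
    by (simp add: chain_exp_def integral_torus_kernel[OF \<psi>])
qed

lemma chain_exp_eq_integral_law:
  "\<psi> \<in> BY \<Longrightarrow> chain_exp v1 v2 \<sigma> N \<tau> x i \<psi> = (\<integral>y. \<psi> y \<partial>law \<tau> i (return borel x))"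
proof (induction i arbitrary: \<psi>)
  case 0
  interpret prob_space "noise 0" by (rule prob_space_noise)
  from 0 show ?case by (simp add: chain_exp_def law_0 integral_return BY_def prob_space)
next
  case (Suc i)
  then show ?case
    by (simp only: chain_exp_Suc Suc.IH[OF integral_torus_kernel_in_BY]
        integral_law_Suc[OF return_in_prob_algebra] space_borel UNIV_I)
qed

lemma Idt_funpow_eq_integral_law:
  assumes "\<And>s. \<phi> s \<in> BY"
  shows "(Idt v1 v2 \<sigma> N ^^ k) \<phi> \<tau> x = (\<integral>y. \<phi> (\<tau> + real k / real N) y \<partial>law \<tau> k (return borel x))"
  using assms
proof (induction k arbitrary: \<phi>)
  case 0
  then show ?case by (simp add: law_0 integral_return BY_def)
next
  case (Suc k)
  have Idt: "Idt v1 v2 \<sigma> N \<phi> s = (\<lambda>y. \<integral>z. \<phi> (s + 1 / real N) z \<partial>torus_kernel s y)" for s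
    using integral_torus_kernel[OF Suc.prems, where \<tau>=s and n=0] by (simp add: Idt_def fun_eq_iff)
  have "(Idt v1 v2 \<sigma> N ^^ Suc k) \<phi> \<tau> x
      = (\<integral>y. Idt v1 v2 \<sigma> N \<phi> (\<tau> + real k / real N) y \<partial>law \<tau> k (return borel x))"
    unfolding funpow_Suc_right comp_def
    by (rule Suc.IH) (simp add: Idt integral_torus_kernel_in_BY Suc.prems)
  then show ?case
    by (simp add: Idt integral_law_Suc return_in_prob_algebra Suc.prems add_divide_distrib ac_simps)
qed

lemma integral_Iper:
  assumes \<mu>: "\<mu> \<in> space (prob_algebra borel)" and \<psi>: "\<psi> \<in> BY"
  shows "(\<integral>x. Iper v1 v2 \<sigma> N \<tau> \<psi> x \<partial>\<mu>) = (\<integral>y. \<psi> y \<partial>law \<tau> N \<mu>)"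
proof -
  obtain B where "\<psi> \<in> UNIV \<rightarrow> {- B..B}"
    using \<psi> by (rule BY_obtain_range)
  then have "(\<integral>y. \<psi> y \<partial>law \<tau> N \<mu>) = (\<integral>x. (\<integral>y. \<psi> y \<partial>law \<tau> N (return borel x)) \<partial>\<mu>)"
    unfolding law_def markov_law_eq_bind[OF \<mu> measurable_torus_kernel] using \<psi>
    by (intro integral_bind_prob_algebra[OF \<mu> measurable_markov_law[OF measurable_torus_kernel]])
       (auto simp: BY_def)
  then show ?thesis
    by (simp add: Iper_def chain_exp_eq_integral_law[OF \<psi>])
qed

lemma torus_prob_invariant_iff:
  "torus_prob \<mu> \<and> invariant v1 v2 \<sigma> N \<tau> \<mu> \<longleftrightarrow> \<mu> \<in> space (prob_algebra borel) \<and> law \<tau> N \<mu> = \<mu>"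
proof (intro iffI conjI; elim conjE)
  assume \<mu>: "torus_prob \<mu>" and inv: "invariant v1 v2 \<sigma> N \<tau> \<mu>"
  then show prob: "\<mu> \<in> space (prob_algebra borel)"
    by (simp add: torus_prob_iff_AE)
  have "torus_prob (law \<tau> N \<mu>)"
    using law_in_prob_algebra[OF prob] AE_law_unit_square[OF prob N_pos] by (simp add: torus_prob_iff_AE)
  then show "law \<tau> N \<mu> = \<mu>"
    using \<mu> inv integral_Iper[OF prob] by (intro torus_prob_eqI) (auto simp: invariant_def)
next
  assume \<mu>: "\<mu> \<in> space (prob_algebra borel)" and stationary: "law \<tau> N \<mu> = \<mu>"
  show "torus_prob \<mu>"
    using \<mu> AE_law_unit_square[OF \<mu> N_pos, of \<tau>, unfolded stationary] by (simp add: torus_prob_iff_AE)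
  show "invariant v1 v2 \<sigma> N \<tau> \<mu>"
    using integral_Iper[OF \<mu>] by (simp add: invariant_def stationary)
qed

lemma law_stationary_ex1: "\<exists>!\<mu>. \<mu> \<in> space (prob_algebra borel) \<and> law \<tau> N \<mu> = \<mu>"
  unfolding law_def using torus_kernel_doeblin N_pos by (rule markov_law_stationary_ex1)

abbreviation \<pi> :: "real \<Rightarrow> (real \<times> real) measure" where
  "\<pi> \<equiv> pi_inv v1 v2 \<sigma> N"

lemma pi_inv_in_prob_algebra: "\<pi> \<tau> \<in> space (prob_algebra borel)"
  and law_pi_inv: "law \<tau> N (\<pi> \<tau>) = \<pi> \<tau>"
  using theI'[OF law_stationary_ex1[of \<tau>]] by (auto simp: pi_inv_def torus_prob_invariant_iff)

lemma pi_inv_eqI: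
  "\<mu> \<in> space (prob_algebra borel) \<Longrightarrow> law \<tau> N \<mu> = \<mu> \<Longrightarrow> \<pi> \<tau> = \<mu>"
  using law_stationary_ex1[of \<tau>] pi_inv_in_prob_algebra law_pi_inv by blast

lemma law_transports_pi_inv: "law \<tau> n (\<pi> \<tau>) = \<pi> (\<tau> + real n / real N)"
proof (rule pi_inv_eqI[symmetric])
  let ?K = "\<lambda>i. torus_kernel (\<tau> + real i / real N)"
  show "law \<tau> n (\<pi> \<tau>) \<in> space (prob_algebra borel)"
    by (rule law_in_prob_algebra[OF pi_inv_in_prob_algebra])
  have "\<tau> + real (N + i) / real N = \<tau> + real i / real N + 1" for i
    using N_pos by (simp add: add_divide_distrib)
  then have "?K (N + i) = ?K i" for i
    by (simp only: torus_kernel_add_1)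
  then have "markov_law (\<lambda>i. ?K (n + i)) N (markov_law ?K n (\<pi> \<tau>)) = markov_law ?K n (\<pi> \<tau>)"
    by (rule markov_law_stationary_shift) (rule law_pi_inv[unfolded law_def])
  then show "law (\<tau> + real n / real N) N (law \<tau> n (\<pi> \<tau>)) = law \<tau> n (\<pi> \<tau>)"
    by (simp add: law_def add_divide_distrib add.assoc)
qed

lemma pi_inv_add_of_nat: "\<pi> (\<tau> + real n) = \<pi> \<tau>"
proof -
  interpret periodic_fun_simple' \<pi>
  proof
    show "\<pi> (s + 1) = \<pi> s" for s
      using law_transports_pi_inv[of s N] N_pos by (simp add: law_pi_inv)
  qed
  show ?thesis by (rule plus_of_nat)
qed

lemma integral_law_converges:
  assumes "\<mu> \<in> space (prob_algebra borel)" "f \<in> borel_measurable borel" "f \<in> UNIV \<rightarrow> {l..u}"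
  shows "\<bar>(\<integral>x. f x \<partial>law \<tau> n \<mu>) - (\<integral>x. f x \<partial>\<pi> (\<tau> + real n / real N))\<bar> \<le> (1 - \<delta>) ^ n * (u - l)"
  unfolding law_transports_pi_inv[symmetric] law_def using assms
  by (intro markov_law_contracts[OF torus_kernel_doeblin _ pi_inv_in_prob_algebra]) simp_all

lemma integral_law_return_converges:
  assumes \<phi>: "\<phi> \<in> BTY"
  shows "\<bar>(\<integral>y. \<phi> s y \<partial>law \<tau> n (return borel x)) - (\<integral>y. \<phi> s y \<partial>\<pi> (\<tau> + real n / real N))\<bar>
    \<le> 2 * supnorm \<phi> * (1 - \<delta>) ^ n"
  using integral_law_converges[OF return_in_prob_algebra _ BTY_range_supnorm[OF \<phi>]] BTY_slice[OF \<phi>]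
  by (simp add: BY_def mult.commute)

definition ergodic_rate :: real where
  "ergodic_rate = - real N * ln (1 - \<delta>)"

lemma ergodic_rate_pos: "ergodic_rate > 0"
  using N_pos weight_pos weight_less_1 by (simp add: ergodic_rate_def mult_pos_neg)

lemma exp_ergodic_rate: "exp (- ergodic_rate * real n) = (1 - \<delta>) ^ (N * n)"
proof -
  have "- ergodic_rate * real n = real (N * n) * ln (1 - \<delta>)" by (simp add: ergodic_rate_def)
  then show ?thesis using weight_less_1 by (simp only: exp_of_nat_mult) simp
qed

lemma period_geometrically_ergodic:
  assumes \<phi>: "\<phi> \<in> BTY"
  shows "\<bar>((Idt v1 v2 \<sigma> N ^^ N) ^^ n) \<phi> \<tau> x - (\<integral>x'. \<phi> \<tau> x' \<partial>\<pi> \<tau>)\<bar>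
    \<le> 2 * supnorm \<phi> * exp (- ergodic_rate * real n)"
proof -
  have "\<tau> + real (N * n) / real N = \<tau> + real n" using N_pos by simp
  then have period: "\<phi> (\<tau> + real (N * n) / real N) = \<phi> \<tau>" "\<pi> (\<tau> + real (N * n) / real N) = \<pi> \<tau>"
    by (simp_all only: BTY_add_of_nat[OF \<phi>] pi_inv_add_of_nat)
  show ?thesis
    using integral_law_return_converges[OF \<phi>, where s=\<tau> and \<tau>=\<tau> and n="N * n" and x=x]
    by (simp only: funpow_mult Idt_funpow_eq_integral_law[OF BTY_slice[OF \<phi>]] period exp_ergodic_rate)
qed

lemma centred_series_convergent:
  assumes \<phi>: "\<phi> \<in> BTY" and centred: "\<And>s. (\<integral>x. \<phi> s x \<partial>\<pi> s) = 0"
  shows "convergent (\<lambda>m. \<Sum>i=1..m. chain_exp v1 v2 \<sigma> N \<tau> x i (\<phi> (\<tau> + real i / real N)))"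
proof -
  let ?term = "\<lambda>i. chain_exp v1 v2 \<sigma> N \<tau> x i (\<phi> (\<tau> + real i / real N))"
  have bound: "norm (?term i) \<le> 2 * supnorm \<phi> * (1 - \<delta>) ^ i" for i
    using integral_law_return_converges[OF \<phi>, where s="\<tau> + real i / real N" and \<tau>=\<tau> and n=i and x=x]
    by (simp add: chain_exp_eq_integral_law BTY_slice[OF \<phi>] centred)
  have "summable (\<lambda>i. 2 * supnorm \<phi> * (1 - \<delta>) ^ i)"
    using weight_pos weight_less_1 by (intro summable_mult summable_geometric) simp
  then have "summable ?term"
    using bound by (rule summable_comparison_test')
  then have "summable (\<lambda>i. ?term (Suc i))"
    by (subst summable_Suc_iff)
  then have "convergent (\<lambda>m. \<Sum>i<m. ?term (Suc i))"
    by (simp only: summable_iff_convergent)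
  then show ?thesis by (simp add: sum.atLeast1_atMost_eq)
qed

lemma period_fixed_imp_eq_average:
  assumes w: "w \<in> BTY" and "(Idt v1 v2 \<sigma> N ^^ N) w = w"
  shows "w \<tau> x = (\<integral>x'. w \<tau> x' \<partial>\<pi> \<tau>)"
proof -
  have fixed: "((Idt v1 v2 \<sigma> N ^^ N) ^^ n) w = w" for n
    using assms(2) by (induction n) simp_all
  have "(\<lambda>n. 2 * supnorm w * (1 - \<delta>) ^ (N * n)) \<longlonglongrightarrow> 2 * supnorm w * 0"
    unfolding power_mult using N_pos weight_pos weight_less_1
    by (intro tendsto_mult tendsto_const LIMSEQ_power_zero) (simp add: power_less_one_iff)
  moreover have "\<bar>w \<tau> x - (\<integral>x'. w \<tau> x' \<partial>\<pi> \<tau>)\<bar> \<le> 2 * supnorm w * (1 - \<delta>) ^ (N * n)" for n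
    using period_geometrically_ergodic[OF w, of n \<tau> x] by (simp only: fixed exp_ergodic_rate)
  ultimately have "\<bar>w \<tau> x - (\<integral>x'. w \<tau> x' \<partial>\<pi> \<tau>)\<bar> \<le> 0"
    by (intro LIMSEQ_le_const) auto
  then show ?thesis by simp
qed

lemma period_fixes_functions_of_time:
  assumes w: "w \<in> BTY" and const: "\<And>\<tau> x. w \<tau> x = c \<tau>"
  shows "(Idt v1 v2 \<sigma> N ^^ N) w = w"
proof (intro ext)
  fix \<tau> x
  have "prob_space (law \<tau> N (return borel x))"
    using law_in_prob_algebra[OF return_in_prob_algebra] by (simp add: space_prob_algebra)
  then have "(Idt v1 v2 \<sigma> N ^^ N) w \<tau> x = w (\<tau> + 1) x"
    using N_pos by (simp add: Idt_funpow_eq_integral_law BTY_slice[OF w] const prob_space.prob_space)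
  also have "\<dots> = w \<tau> x"
    using BTY_add_of_nat[OF w, of \<tau> 1] by simp
  finally show "(Idt v1 v2 \<sigma> N ^^ N) w \<tau> x = w \<tau> x" .
qed

lemma period_fixed_iff_function_of_time:
  assumes w: "w \<in> BTY"
  shows "(Idt v1 v2 \<sigma> N ^^ N) w = w \<longleftrightarrow> (\<exists>c. (\<forall>\<tau>. c (\<tau> + 1) = c \<tau>) \<and> (\<forall>\<tau> x. w \<tau> x = c \<tau>))"
proof
  assume fixed: "(Idt v1 v2 \<sigma> N ^^ N) w = w"
  show "\<exists>c. (\<forall>\<tau>. c (\<tau> + 1) = c \<tau>) \<and> (\<forall>\<tau> x. w \<tau> x = c \<tau>)"
  proof (intro exI conjI allI)
    show "w \<tau> x = (\<integral>x'. w \<tau> x' \<partial>\<pi> \<tau>)" for \<tau> x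
      by (rule period_fixed_imp_eq_average[OF w fixed])
    show "(\<integral>x'. w (\<tau> + 1) x' \<partial>\<pi> (\<tau> + 1)) = (\<integral>x'. w \<tau> x' \<partial>\<pi> \<tau>)" for \<tau>
      using BTY_add_of_nat[OF w, of \<tau> 1] pi_inv_add_of_nat[of \<tau> 1] by simp
  qed
qed (use period_fixes_functions_of_time[OF w] in blast)

end

lemma smooth2_imp_continuous_on:
  assumes "smooth2 v"
  shows "continuous_on A (v t)"
proof -
  have "(\<lambda>p. v (fst p) (snd p)) differentiable (at z)" for z
    using assms[unfolded smooth2_def, rule_format, of "[]"] by simp
  then have "continuous_on UNIV (\<lambda>p. v (fst p) (snd p))"
    by (simp add: continuous_at_imp_continuous_on differentiable_imp_continuous_within)
  then have "continuous_on A (\<lambda>y. v (fst (t, y)) (snd (t, y)))"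
    by (rule continuous_on_compose2) (auto intro: continuous_intros)
  then show ?thesis by simp
qed

theorem theorem4p2:
  fixes v1 v2 :: "real \<Rightarrow> real \<Rightarrow> real" and \<sigma> :: real and N :: nat
  assumes sigma_pos: "\<sigma> > 0"
    and N_pos: "N > 0"
    and v1_smooth: "smooth2 v1" and v2_smooth: "smooth2 v2"
    and v1_per: "\<forall>t y. v1 (t + 1) y = v1 t y \<and> v1 t (y + 1) = v1 t y"
    and v2_per: "\<forall>t y. v2 (t + 1) y = v2 t y \<and> v2 t (y + 1) = v2 t y"
    and v1_mean: "\<forall>t. integral {0..1} (\<lambda>y. v1 t y) = 0"
    and v2_mean: "\<forall>t. integral {0..1} (\<lambda>y. v2 t y) = 0"
  shows
    "(\<exists>C>0. \<exists>\<rho>>0. \<forall>\<phi>\<in>BTY. \<forall>n::nat. \<forall>\<tau> x.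
        \<bar>((Idt v1 v2 \<sigma> N ^^ N) ^^ n) \<phi> \<tau> x - (\<integral>x'. \<phi> \<tau> x' \<partial>pi_inv v1 v2 \<sigma> N \<tau>)\<bar>
          \<le> C * supnorm \<phi> * exp (- \<rho> * real n))
   \<and> (\<forall>\<phi>\<in>BTY. (\<forall>s. (\<integral>x. \<phi> s x \<partial>pi_inv v1 v2 \<sigma> N s) = 0) \<longrightarrow>
        (\<forall>\<tau> x. convergent (\<lambda>m. \<Sum>i=1..m.
            chain_exp v1 v2 \<sigma> N \<tau> x i (\<phi> (\<tau> + real i / real N)))))
   \<and> {w \<in> BTY. (\<lambda>\<tau> x. w \<tau> x - (Idt v1 v2 \<sigma> N ^^ N) w \<tau> x) = (\<lambda>_ _. 0)}
       = {w \<in> BTY. \<exists>c. (\<forall>\<tau>. c (\<tau> + 1) = c \<tau>) \<and> (\<forall>\<tau> x. w \<tau> x = c \<tau>)}"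
proof -
  have "v1 t \<in> borel_measurable borel" "v2 t \<in> borel_measurable borel" for t
    using smooth2_imp_continuous_on v1_smooth v2_smooth
    by (blast intro: borel_measurable_continuous_onI)+
  then interpret splitting_scheme v1 v2 \<sigma> N
    using sigma_pos N_pos v1_per v2_per by unfold_locales (auto simp: fun_eq_iff)
  show ?thesis
  proof (intro conjI)
    show "\<exists>C>0. \<exists>\<rho>>0. \<forall>\<phi>\<in>BTY. \<forall>n::nat. \<forall>\<tau> x.
        \<bar>((Idt v1 v2 \<sigma> N ^^ N) ^^ n) \<phi> \<tau> x - (\<integral>x'. \<phi> \<tau> x' \<partial>\<pi> \<tau>)\<bar> \<le> C * supnorm \<phi> * exp (- \<rho> * real n)"
      using period_geometrically_ergodic ergodic_rate_pos
      by (intro exI[of _ 2] exI[of _ ergodic_rate] conjI ballI allI) simp_all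
    show "\<forall>\<phi>\<in>BTY. (\<forall>s. (\<integral>x. \<phi> s x \<partial>\<pi> s) = 0) \<longrightarrow>
        (\<forall>\<tau> x. convergent (\<lambda>m. \<Sum>i=1..m. chain_exp v1 v2 \<sigma> N \<tau> x i (\<phi> (\<tau> + real i / real N))))"
      using centred_series_convergent by blast
    have "(\<lambda>\<tau> x. w \<tau> x - (Idt v1 v2 \<sigma> N ^^ N) w \<tau> x) = (\<lambda>_ _. 0) \<longleftrightarrow> (Idt v1 v2 \<sigma> N ^^ N) w = w" for w
      by (auto simp: fun_eq_iff)
    with period_fixed_iff_function_of_time
    show "{w \<in> BTY. (\<lambda>\<tau> x. w \<tau> x - (Idt v1 v2 \<sigma> N ^^ N) w \<tau> x) = (\<lambda>_ _. 0)}
        = {w \<in> BTY. \<exists>c. (\<forall>\<tau>. c (\<tau> + 1) = c \<tau>) \<and> (\<forall>\<tau> x. w \<tau> x = c \<tau>)}"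
      by (intro Collect_cong) blast
  qed
qed

end
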